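(* Let $T$ be a tree on $\{1,\ldots,n\}$, let $O(T)$ be the set of orderings of $E(T)$, and $C(T)$ the set of cycles arising as products of the edge-transpositions over orderings in $O(T)$. For $\sigma\in O(T)$ let $c_\sigma$ be its product and $p_\sigma$ its associated partial order. Then the map $c_\sigma\mapsto p_\sigma$ is a well-defined bijection from $C(T)$ onto $P(T)=\{p_\sigma:\sigma\in O(T)\}$, and for each $\sigma\in O(T)$ the set of orderings $\tau\in O(T)$ with $c_\tau=c_\sigma$ is exactly the set of linear extensions $L(p_\sigma)$ (viewing orderings as linear orders on $E(T)$).
   Context: Each edge $\{i,j\}$ is regarded as the transposition $(i,j)$. An ordering $\sigma=e_1e_2\cdots e_{n-1}$ of $E(T)$ (each edge exactly once) is identified with the linear order $e_1<e_2<\cdots<e_{n-1}$ on $E(T)$. For a vertex $i$, the local suborder $\sigma|_i$ is the restriction of this linear order to the set of edges incident with $i$. The partial order $p_\sigma$ on $E(T)$ is the transitive closure of $\bigcup_{i=1}^n\sigma|_i$. $L(p)$ denotes the set of linear orders on $E(T)$ containing the partial order $p$. *)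

theory Defs
  imports "HOL-Combinatorics.Combinatorics"
begin

definition simple_graph_on :: "nat \<Rightarrow> nat set set \<Rightarrow> bool" where
  "simple_graph_on n E \<longleftrightarrow> (\<forall>e\<in>E. e \<subseteq> {1..n} \<and> card e = 2)"

definition graph_connected :: "nat \<Rightarrow> nat set set \<Rightarrow> bool" where
  "graph_connected n E \<longleftrightarrow> (\<forall>u\<in>{1..n}. \<forall>v\<in>{1..n}. (u, v) \<in> {(x, y). {x, y} \<in> E}\<^sup>*)"

definition graph_cycle :: "nat set set \<Rightarrow> nat list \<Rightarrow> bool" where
  "graph_cycle E vs \<longleftrightarrow> length vs \<ge> 3 \<and> distinct vs \<and>
     (\<forall>i. Suc i < length vs \<longrightarrow> {vs ! i, vs ! Suc i} \<in> E) \<and> {last vs, hd vs} \<in> E"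

text \<open>A tree on the vertex set \<open>{1..n}\<close> is given by its edge set; the empty graph is not a tree.\<close>

definition tree_on :: "nat \<Rightarrow> nat set set \<Rightarrow> bool" where
  "tree_on n E \<longleftrightarrow> n \<ge> 1 \<and> simple_graph_on n E \<and> graph_connected n E \<and> (\<nexists>vs. graph_cycle E vs)"

text \<open>Orderings are words \<open>e\<^sub>1 e\<^sub>2 \<dots>\<close> in which each edge occurs exactly once.\<close>

abbreviation orderings :: "nat set set \<Rightarrow> nat set list set" where
  "orderings E \<equiv> permutations_of_set E"

definition edge_transposition :: "nat set \<Rightarrow> nat \<Rightarrow> nat" where
  "edge_transposition e = transpose (Min e) (Max e)"

lemma edge_transposition_doubleton: "edge_transposition {i, j} = transpose i j"
  by (cases "i \<le> j") (auto simp: edge_transposition_def transpose_commute max_def min_def)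

text \<open>The product of a word is \<open>e\<^sub>1 \<circ> e\<^sub>2 \<circ> \<dots>\<close>, the rightmost transposition acting first.
  Multiplying in the opposite direction would replace each product by its inverse.\<close>

definition ordering_product :: "nat set list \<Rightarrow> nat \<Rightarrow> nat" where
  "ordering_product \<sigma> = foldr (\<circ>) (map edge_transposition \<sigma>) id"

text \<open>The identity counts as a cycle (of length one); it is the only product when \<open>n = 1\<close>.\<close>

definition is_cycle_on :: "nat \<Rightarrow> (nat \<Rightarrow> nat) \<Rightarrow> bool" where
  "is_cycle_on n c \<longleftrightarrow> (\<exists>cs. cs \<noteq> [] \<and> distinct cs \<and> set cs \<subseteq> {1..n} \<and> c = cycle_of_list cs)"

definition product_cycles :: "nat \<Rightarrow> nat set set \<Rightarrow> (nat \<Rightarrow> nat) set" where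
  "product_cycles n E = {c. is_cycle_on n c \<and> (\<exists>\<sigma>\<in>orderings E. c = ordering_product \<sigma>)}"

text \<open>All orders are taken in their reflexive form, as for \<^const>\<open>linear_order_on\<close>.\<close>

definition order_of_list :: "'a list \<Rightarrow> 'a rel" where
  "order_of_list \<sigma> = {(\<sigma> ! i, \<sigma> ! j) | i j. i \<le> j \<and> j < length \<sigma>}"

definition local_suborder :: "nat set list \<Rightarrow> nat \<Rightarrow> nat set rel" where
  "local_suborder \<sigma> i = Restr (order_of_list \<sigma>) {e \<in> set \<sigma>. i \<in> e}"

definition ordering_poset :: "nat \<Rightarrow> nat set list \<Rightarrow> nat set rel" where
  "ordering_poset n \<sigma> = (\<Union>i\<in>{1..n}. local_suborder \<sigma> i)\<^sup>+"

definition linear_extensions :: "'a set \<Rightarrow> 'a rel \<Rightarrow> 'a rel set" where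
  "linear_extensions A p = {r. linear_order_on A r \<and> p \<subseteq> r}"

end

theory Submission
  imports Defs
begin

text \<open>Two orderings of the edges of a forest have the same product iff they order every pair of
  intersecting edges alike. If they do, the first edge of one word can be moved to the front of the
  other past edges disjoint from it. Conversely, let \<open>a = {u, v}\<close> be the last edge of \<open>\<sigma>\<close>. Deleting
  \<open>a\<close> separates \<open>u\<close> from \<open>v\<close>, and the product sends each end of \<open>a\<close> to the other side; since the
  product over a forest moves every vertex that it touches, in any word with the same product all
  edges after \<open>a\<close> are disjoint from \<open>a\<close>, so \<open>a\<close> can be cancelled.\<close>

section \<open>Orders given by lists\<close>

lemma order_of_list_Nil [simp]: "order_of_list [] = {}"
  by (simp add: order_of_list_def)

lemma order_of_list_Cons:
  "order_of_list (x # xs) = {x} \<times> insert x (set xs) \<union> order_of_list xs"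
proof (intro set_eqI iffI)
  fix z assume "z \<in> order_of_list (x # xs)"
  then obtain i j where z: "z = ((x # xs) ! i, (x # xs) ! j)" and ij: "i \<le> j" "j < Suc (length xs)"
    by (auto simp: order_of_list_def)
  show "z \<in> {x} \<times> insert x (set xs) \<union> order_of_list xs"
  proof (cases i)
    case 0
    have "(x # xs) ! j \<in> set (x # xs)"
      using ij by (intro nth_mem) simp
    with 0 z show ?thesis by auto
  next
    case (Suc i')
    with ij obtain j' where "j = Suc j'" by (cases j) auto
    with Suc z ij have "z = (xs ! i', xs ! j') \<and> i' \<le> j' \<and> j' < length xs" by simp
    then show ?thesis by (auto simp: order_of_list_def)
  qed
next
  fix z assume "z \<in> {x} \<times> insert x (set xs) \<union> order_of_list xs"
  then consider y where "z = (x, y)" "y \<in> set (x # xs)" | "z \<in> order_of_list xs"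
    by auto
  then show "z \<in> order_of_list (x # xs)"
  proof cases
    case 1
    then obtain j where "j < length (x # xs)" "(x # xs) ! j = y"
      by (metis in_set_conv_nth)
    with 1 have "z = ((x # xs) ! 0, (x # xs) ! j) \<and> 0 \<le> j \<and> j < length (x # xs)" by simp
    then show ?thesis unfolding order_of_list_def by blast
  next
    case 2
    then obtain i j where "z = (xs ! i, xs ! j)" "i \<le> j" "j < length xs"
      by (auto simp: order_of_list_def)
    then have "z = ((x # xs) ! Suc i, (x # xs) ! Suc j) \<and> Suc i \<le> Suc j \<and> Suc j < length (x # xs)"
      by simp
    then show ?thesis unfolding order_of_list_def by blast
  qed
qed

lemma order_of_list_append:
  "order_of_list (xs @ ys) = order_of_list xs \<union> set xs \<times> set ys \<union> order_of_list ys"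
  by (induction xs) (auto simp: order_of_list_Cons)

lemma order_of_list_subset: "order_of_list xs \<subseteq> set xs \<times> set xs"
  by (induction xs) (auto simp: order_of_list_Cons)

lemma order_of_list_remove:
  assumes "distinct (xs @ a # ys)"
  shows "order_of_list (xs @ ys) = {(e, f) \<in> order_of_list (xs @ a # ys). e \<noteq> a \<and> f \<noteq> a}"
  using assms order_of_list_subset[of xs] order_of_list_subset[of ys]
  by (auto simp: order_of_list_append order_of_list_Cons)

lemma linear_order_on_order_of_list:
  assumes "distinct xs"
  shows "linear_order_on (set xs) (order_of_list xs)"
proof -
  have "refl_on (set xs) (order_of_list xs)"
    by (induction xs) (auto simp: order_of_list_Cons refl_on_def)
  moreover have "total_on (set xs) (order_of_list xs)"
    by (induction xs) (auto simp: order_of_list_Cons total_on_def)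
  moreover have "antisym (order_of_list xs)" and "trans (order_of_list xs)"
    using assms
  proof (induction xs)
    case (Cons x xs)
    have sub: "order_of_list xs \<subseteq> set xs \<times> set xs" by (rule order_of_list_subset)
    {
      case 1
      with Cons.IH(1) sub show ?case
        by (auto simp: order_of_list_Cons antisym_def)
    next
      case 2
      with Cons.IH(2) sub show ?case
        unfolding order_of_list_Cons trans_def by auto
    }
  qed simp_all
  ultimately show ?thesis
    using order_of_list_subset[of xs] by (simp add: order_on_defs)
qed

text \<open>This turns an abstract linear extension back into an ordering of the edges. The word is
  built by taking the least element as head and recursing on the rest.\<close>

lemma finite_linear_order_eq_order_of_list:
  assumes "finite A" "linear_order_on A r"
  shows "\<exists>xs\<in>permutations_of_set A. order_of_list xs = r"
  using assms
proof (induction A arbitrary: r rule: finite_psubset_induct)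
  case (psubset A)
  note lin = psubset.prems
  show ?case
  proof (cases "A = {}")
    case True
    with lin show ?thesis by (auto simp: order_on_defs)
  next
    case False
    have sub: "r \<subseteq> A \<times> A" using lin by (simp add: order_on_defs)
    with \<open>finite A\<close> have "finite r" by (meson finite_SigmaI finite_subset)
    \<comment> \<open>The strict part of a finite linear order is well-founded, so it has a minimal
      element; totality makes that element least.\<close>
    then have "wf (r - Id)"
      using lin by (simp add: linear_order_on_acyclic finite_acyclic_wf)
    with False obtain a where a: "a \<in> A" and min: "\<And>y. (y, a) \<in> r - Id \<Longrightarrow> y \<notin> A"
      using wfE_min'[of "r - Id" A] by metis
    have below: "(a, y) \<in> r" if "y \<in> A" for y
      using that a min[of y] lin by (cases "y = a") (auto simp: order_on_defs total_on_def refl_on_def)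
    let ?r = "Restr r (A - {a})"
    have "trans ?r" "antisym ?r"
      using lin by (auto simp: order_on_defs intro: trans_Restr antisym_subset)
    moreover have "refl_on (A - {a}) ?r" "total_on (A - {a}) ?r"
      using lin by (auto simp: order_on_defs refl_on_def total_on_def)
    ultimately have "linear_order_on (A - {a}) ?r"
      by (auto simp: order_on_defs)
    then obtain xs where xs: "xs \<in> permutations_of_set (A - {a})" "order_of_list xs = ?r"
      using psubset.IH[of "A - {a}"] a by blast
    have "r = {a} \<times> A \<union> ?r"
    proof
      show "r \<subseteq> {a} \<times> A \<union> ?r" using sub min by fastforce
      show "{a} \<times> A \<union> ?r \<subseteq> r" using below by auto
    qed
    then have "order_of_list (a # xs) = r"
      using xs a by (simp add: order_of_list_Cons permutations_of_set_def insert_absorb)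
    moreover have "a # xs \<in> permutations_of_set A"
      using xs a by (auto simp: permutations_of_set_def)
    ultimately show ?thesis by blast
  qed
qed

section \<open>Forests\<close>

definition reach :: "nat set set \<Rightarrow> nat rel" where
  "reach F = {(x, y). {x, y} \<in> F}\<^sup>*"

text \<open>Every edge is a bridge. This form of acyclicity passes to subsets and directly yields
  the separation of the ends of a deleted edge. Loops are excluded because \<open>reach\<close> is
  reflexive.\<close>

definition forest :: "nat set set \<Rightarrow> bool" where
  "forest F \<longleftrightarrow> (\<forall>e\<in>F. \<exists>u v. e = {u, v} \<and> (u, v) \<notin> reach (F - {e}))"

lemma reach_refl [simp]: "(x, x) \<in> reach F"
  by (simp add: reach_def)

lemma reach_trans: "(x, y) \<in> reach F \<Longrightarrow> (y, z) \<in> reach F \<Longrightarrow> (x, z) \<in> reach F"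
  unfolding reach_def by (rule rtrancl_trans)

lemma reach_sym: "(x, y) \<in> reach F \<Longrightarrow> (y, x) \<in> reach F"
proof -
  have "sym {(x, y). {x, y} \<in> F}" by (auto simp: sym_def insert_commute)
  then show "(x, y) \<in> reach F \<Longrightarrow> (y, x) \<in> reach F"
    unfolding reach_def by (meson sym_rtrancl symD)
qed

lemma reach_mono: "F \<subseteq> G \<Longrightarrow> reach F \<subseteq> reach G"
  unfolding reach_def by (rule rtrancl_mono) auto

lemma forestE:
  assumes "forest F" "e \<in> F"
  obtains u v where "e = {u, v}" "u \<noteq> v" "(u, v) \<notin> reach (F - {e})" "(v, u) \<notin> reach (F - {e})"
proof -
  obtain u v where uv: "e = {u, v}" "(u, v) \<notin> reach (F - {e})"
    using assms unfolding forest_def by meson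
  moreover from uv(2) have "u \<noteq> v" by auto
  moreover from uv(2) have "(v, u) \<notin> reach (F - {e})" using reach_sym by blast
  ultimately show thesis using that by blast
qed

text \<open>Set-up for inductions on the last letter: by distinctness, deleting \<open>a\<close>
  leaves exactly the edges of the remaining word.\<close>

lemma forest_last_edgeE:
  assumes "distinct (\<sigma> @ [a])" "forest (set (\<sigma> @ [a]))"
  obtains u v where "a = {u, v}" "(u, v) \<notin> reach (set \<sigma>)" "(v, u) \<notin> reach (set \<sigma>)"
proof -
  have "set (\<sigma> @ [a]) - {a} = set \<sigma>" using assms(1) by auto
  moreover obtain u v where "a = {u, v}" "u \<noteq> v"
    "(u, v) \<notin> reach (set (\<sigma> @ [a]) - {a})" "(v, u) \<notin> reach (set (\<sigma> @ [a]) - {a})"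
    using forestE[OF assms(2), of a] by (metis in_set_conv_decomp)
  ultimately show thesis using that[of u v] by simp
qed

lemma forest_subset:
  assumes "forest F" "G \<subseteq> F"
  shows "forest G"
proof -
  have "reach (G - {e}) \<subseteq> reach (F - {e})" for e
    using assms by (intro reach_mono) auto
  with assms show ?thesis unfolding forest_def by (meson subset_iff)
qed

lemma forest_card: "forest F \<Longrightarrow> e \<in> F \<Longrightarrow> card e = 2"
  by (erule (1) forestE) simp

lemma rtrancl_imp_distinct_path:
  assumes "(x, y) \<in> r\<^sup>*"
  shows "\<exists>vs. vs \<noteq> [] \<and> hd vs = x \<and> last vs = y \<and> distinct vs \<and> successively (\<lambda>a b. (a, b) \<in> r) vs"
  using assms
proof (induction rule: converse_rtrancl_induct)
  case base
  show ?case by (rule exI[of _ "[y]"]) simp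
next
  case (step x z)
  then obtain vs where vs: "vs \<noteq> []" "hd vs = z" "last vs = y" "distinct vs"
    "successively (\<lambda>a b. (a, b) \<in> r) vs" by blast
  show ?case
  proof (cases "x \<in> set vs")
    \<comment> \<open>The start already lies on the path, so the detour before its occurrence is cut
      off.\<close>
    case True
    then obtain as bs where "vs = as @ x # bs" by (meson split_list)
    with vs show ?thesis
      by (intro exI[of _ "x # bs"]) (auto simp: successively_append_iff)
  next
    case False
    with vs step(1) show ?thesis
      by (intro exI[of _ "x # vs"]) (auto simp: successively_Cons)
  qed
qed

text \<open>If deleting an edge did not separate its ends, a repetition-free path between them would
  close up with that edge to a cycle.\<close>

lemma forest_if_no_graph_cycle:
  assumes card: "\<And>e. e \<in> E \<Longrightarrow> card e = 2" and acyc: "\<nexists>vs. graph_cycle E vs"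
  shows "forest E"
  unfolding forest_def
proof
  fix e assume "e \<in> E"
  with card obtain u v where e: "e = {u, v}" "u \<noteq> v" by (metis card_2_iff)
  have "(u, v) \<notin> reach (E - {e})"
  proof
    assume "(u, v) \<in> reach (E - {e})"
    then obtain vs where vs: "vs \<noteq> []" "hd vs = u" "last vs = v" "distinct vs"
      and path: "successively (\<lambda>a b. {a, b} \<in> E - {e}) vs"
      unfolding reach_def by (auto dest!: rtrancl_imp_distinct_path)
    \<comment> \<open>A path with one vertex would give \<open>u = v\<close>; one with two vertices
      would use the deleted edge \<open>e\<close> itself.\<close>
    have "length vs \<ge> 3"
    proof (cases vs)
      case (Cons a ws)
      show ?thesis
      proof (cases ws)
        case Nil
        with Cons vs e show ?thesis by simp
      next
        case (Cons b xs)
        with \<open>vs = a # ws\<close> vs e path show ?thesis by (cases xs) auto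
      qed
    qed (use vs in simp)
    moreover have "\<forall>i. Suc i < length vs \<longrightarrow> {vs ! i, vs ! Suc i} \<in> E"
      using path by (simp add: successively_conv_nth)
    moreover have "{last vs, hd vs} \<in> E"
      using vs e \<open>e \<in> E\<close> by (simp add: insert_commute)
    ultimately have "graph_cycle E vs"
      using vs by (simp add: graph_cycle_def)
    with acyc show False by blast
  qed
  with e show "\<exists>u v. e = {u, v} \<and> (u, v) \<notin> reach (E - {e})" by blast
qed

section \<open>Products of edge transpositions\<close>

lemma ordering_product_Nil [simp]: "ordering_product [] = id"
  by (simp add: ordering_product_def)

lemma ordering_product_Cons [simp]:
  "ordering_product (e # \<sigma>) = edge_transposition e \<circ> ordering_product \<sigma>"
  by (simp add: ordering_product_def)

lemma ordering_product_append [simp]: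
  "ordering_product (\<sigma> @ \<tau>) = ordering_product \<sigma> \<circ> ordering_product \<tau>"
  by (induction \<sigma>) (simp_all add: comp_assoc)

lemma edge_transposition_involutory [simp]: "edge_transposition e (edge_transposition e x) = x"
  by (simp add: edge_transposition_def)

lemma edge_transposition_comp_self [simp]: "edge_transposition e \<circ> edge_transposition e = id"
  by (simp add: fun_eq_iff)

lemma bij_ordering_product: "bij (ordering_product \<sigma>)"
proof (induction \<sigma>)
  case (Cons e \<sigma>)
  moreover have "bij (edge_transposition e)" by (simp add: edge_transposition_def)
  ultimately show ?case by (simp only: ordering_product_Cons bij_comp)
qed (simp add: id_def[symmetric])

lemma edge_transposition_notin: "card e = 2 \<Longrightarrow> x \<notin> e \<Longrightarrow> edge_transposition e x = x"
  by (auto simp: card_2_iff edge_transposition_doubleton transpose_def)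

lemma ordering_product_untouched:
  assumes "\<And>e. e \<in> set \<sigma> \<Longrightarrow> card e = 2" "x \<notin> \<Union> (set \<sigma>)"
  shows "ordering_product \<sigma> x = x"
  using assms by (induction \<sigma>) (auto simp: edge_transposition_notin)

lemma edge_transposition_commute:
  assumes "card e = 2" "card f = 2" "e \<inter> f = {}"
  shows "edge_transposition e \<circ> edge_transposition f = edge_transposition f \<circ> edge_transposition e"
proof -
  obtain i j k l where "e = {i, j}" "f = {k, l}"
    using assms by (meson card_2_iff)
  with assms(3) show ?thesis
    by (auto simp: edge_transposition_doubleton transpose_def fun_eq_iff)
qed

lemma ordering_product_commute:
  assumes "\<And>e. e \<in> set \<sigma> \<Longrightarrow> card e = 2 \<and> e \<inter> a = {}" "card a = 2"
  shows "ordering_product \<sigma> \<circ> edge_transposition a = edge_transposition a \<circ> ordering_product \<sigma>"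
  using assms(1)
proof (induction \<sigma>)
  case (Cons e \<sigma>)
  then have IH: "ordering_product \<sigma> \<circ> edge_transposition a = edge_transposition a \<circ> ordering_product \<sigma>"
    by (meson list.set_intros(2))
  have "edge_transposition e \<circ> edge_transposition a = edge_transposition a \<circ> edge_transposition e"
    using Cons.prems assms(2) by (intro edge_transposition_commute) auto
  with IH show ?case by (simp only: ordering_product_Cons comp_assoc) (metis comp_assoc)
qed simp

text \<open>Each letter moves a point at most across one edge of \<open>F\<close>, so the product
  preserves the components of \<open>F\<close>. Letting \<open>F\<close> exceed the set of letters
  allows subwords to be treated within the same components.\<close>

lemma ordering_product_reach:
  assumes "\<And>e. e \<in> set \<sigma> \<Longrightarrow> card e = 2" "set \<sigma> \<subseteq> F"
  shows "(x, ordering_product \<sigma> x) \<in> reach F"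
  using assms
proof (induction \<sigma>)
  case (Cons e \<sigma>)
  obtain u v where e: "e = {u, v}" using Cons.prems by (metis card_2_iff list.set_intros(1))
  with Cons.prems have "{u, v} \<in> F" "{v, u} \<in> F" by (simp_all add: insert_commute)
  then have "(y, edge_transposition e y) \<in> reach F" for y
    by (auto simp: e edge_transposition_doubleton transpose_def reach_def)
  moreover have "(x, ordering_product \<sigma> x) \<in> reach F"
    using Cons.prems by (intro Cons.IH) auto
  ultimately show ?case
    unfolding ordering_product_Cons comp_apply by (blast intro: reach_trans)
qed simp

text \<open>The last edge \<open>a\<close> acts first. It carries one of its ends to the other, and
  the rest of the word cannot leave the component reached, which excludes the starting end. Every
  other vertex is fixed by \<open>a\<close> and is handled by induction.\<close>

lemma forest_ordering_product_moves:
  assumes "distinct \<sigma>" "forest (set \<sigma>)" "x \<in> \<Union> (set \<sigma>)"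
  shows "ordering_product \<sigma> x \<noteq> x"
  using assms
proof (induction \<sigma> rule: rev_induct)
  case (snoc a \<sigma>)
  obtain u v where a: "a = {u, v}" "(u, v) \<notin> reach (set \<sigma>)" "(v, u) \<notin> reach (set \<sigma>)"
    using snoc.prems(1,2) by (rule forest_last_edgeE)
  have fo: "forest (set \<sigma>)" using snoc.prems(2) by (rule forest_subset) auto
  have stay: "(y, ordering_product \<sigma> y) \<in> reach (set \<sigma>)" for y
    using forest_card[OF fo] by (intro ordering_product_reach) auto
  show ?case
  proof (cases "x \<in> a")
    case True
    then consider "x = u" | "x = v" using a by auto
    then show ?thesis
    proof cases
      case 1
      with a have "ordering_product (\<sigma> @ [a]) x = ordering_product \<sigma> v"
        by (simp add: edge_transposition_doubleton)
      with stay[of v] a 1 show ?thesis by metis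
    next
      case 2
      with a have "ordering_product (\<sigma> @ [a]) x = ordering_product \<sigma> u"
        by (simp add: edge_transposition_doubleton)
      with stay[of u] a 2 show ?thesis by metis
    qed
  next
    case False
    then have "ordering_product (\<sigma> @ [a]) x = ordering_product \<sigma> x"
      using forest_card[OF snoc.prems(2), of a] by (simp add: edge_transposition_notin)
    moreover have "ordering_product \<sigma> x \<noteq> x"
      using False snoc.prems fo by (intro snoc.IH) auto
    ultimately show ?thesis by simp
  qed
qed simp

section \<open>Local orders determine, and are determined by, the product\<close>

text \<open>For edges inside \<open>{1..n}\<close> this is the union of the local suborders, before
  the transitive closure and without reference to the vertex set.\<close>

definition touching_order :: "'a set list \<Rightarrow> 'a set rel" where
  "touching_order \<sigma> = {(e, f) \<in> order_of_list \<sigma>. e \<inter> f \<noteq> {}}"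

lemma touching_order_remove:
  assumes "distinct (\<sigma> @ a # \<tau>)"
  shows "touching_order (\<sigma> @ \<tau>) = {(e, f) \<in> touching_order (\<sigma> @ a # \<tau>). e \<noteq> a \<and> f \<noteq> a}"
  unfolding touching_order_def order_of_list_remove[OF assms] by auto

text \<open>Induction on \<tau>: its first edge is deleted from both words, which keeps the touching
  orders equal, and is then moved to the front of \<sigma>.\<close>

lemma ordering_product_eq_if_touching_order_eq:
  assumes "distinct \<sigma>" "distinct \<tau>" "set \<sigma> = set \<tau>" "\<And>e. e \<in> set \<tau> \<Longrightarrow> card e = 2"
    "touching_order \<sigma> = touching_order \<tau>"
  shows "ordering_product \<sigma> = ordering_product \<tau>"
  using assms
proof (induction \<tau> arbitrary: \<sigma>)
  case (Cons a \<tau>)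
  obtain \<alpha> \<beta> where \<sigma>: "\<sigma> = \<alpha> @ a # \<beta>"
    using Cons.prems(3) by (metis list.set_intros(1) split_list)
  have "touching_order (\<alpha> @ \<beta>) = touching_order \<tau>"
    using touching_order_remove[of \<alpha> a \<beta>] touching_order_remove[of "[]" a \<tau>] Cons.prems(1,2,5) \<sigma>
    by simp
  moreover have sets: "set (\<alpha> @ \<beta>) = set \<tau>"
    using Cons.prems(1-3) \<sigma> by auto
  ultimately have IH: "ordering_product (\<alpha> @ \<beta>) = ordering_product \<tau>"
    using Cons.prems(1,2,4) \<sigma> by (intro Cons.IH) auto
  \<comment> \<open>An edge before \<open>a\<close> in \<sigma> that met \<open>a\<close> would also
    have to precede \<open>a\<close> in \<open>a # \<tau>\<close>, where \<open>a\<close> comes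
    first.\<close>
  have "card e = 2 \<and> e \<inter> a = {}" if "e \<in> set \<alpha>" for e
  proof
    show "card e = 2" using that sets Cons.prems(4) by auto
    have "(e, a) \<in> order_of_list \<sigma>"
      using that by (simp add: \<sigma> order_of_list_append)
    moreover have "(e, a) \<notin> order_of_list (a # \<tau>)"
      using that Cons.prems(1,2) \<sigma> order_of_list_subset[of \<tau>] by (auto simp: order_of_list_Cons)
    ultimately show "e \<inter> a = {}"
      using Cons.prems(5) unfolding touching_order_def by blast
  qed
  then have "ordering_product \<alpha> \<circ> edge_transposition a = edge_transposition a \<circ> ordering_product \<alpha>"
    using Cons.prems(4) by (intro ordering_product_commute) auto
  with IH show ?case
    by (metis \<sigma> comp_assoc ordering_product_Cons ordering_product_append)
qed simp

text \<open>Induction on the last edge \<open>a\<close> of \<sigma>. Once the edges after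
  \<open>a\<close> in \<tau> are known to avoid \<open>a\<close>, it commutes to the end of \<tau>
  and cancels, so the induction hypothesis compares \<sigma> with \<tau> deprived of
  \<open>a\<close>.\<close>

lemma touching_order_eq_if_ordering_product_eq:
  assumes "distinct \<sigma>" "distinct \<tau>" "set \<sigma> = set \<tau>" "forest (set \<sigma>)"
    "ordering_product \<sigma> = ordering_product \<tau>"
  shows "touching_order \<sigma> = touching_order \<tau>"
  using assms
proof (induction \<sigma> arbitrary: \<tau> rule: rev_induct)
  case (snoc a \<sigma>)
  have card: "card e = 2" if "e \<in> insert a (set \<sigma>)" for e
    using that forest_card[OF snoc.prems(4)] by auto
  have "a \<in> set \<tau>" using snoc.prems(3) by (metis in_set_conv_decomp)
  then obtain \<alpha> \<beta> where \<tau>: "\<tau> = \<alpha> @ a # \<beta>" by (meson split_list)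
  have sets: "set (\<alpha> @ \<beta>) = set \<sigma>" using snoc.prems(1-3) \<tau> by auto
  have fo: "forest (set \<sigma>)" using snoc.prems(4) by (rule forest_subset) auto
  have stay: "(x, ordering_product \<rho> x) \<in> reach (set \<sigma>)" if "set \<rho> \<subseteq> set \<sigma>" for \<rho> x
    using that card by (intro ordering_product_reach) auto
  \<comment> \<open>Applied to an end \<open>u\<close> of \<open>a\<close>, the product crosses \<open>a\<close>, so \<open>\<beta>\<close> must not have moved \<open>u\<close> away from \<open>a\<close>.\<close>
  have fix_end: "u \<notin> \<Union> (set \<beta>)"
    if a: "a = {u, v}" "(u, v) \<notin> reach (set \<sigma>)" for u v
  proof
    assume u: "u \<in> \<Union> (set \<beta>)"
    define w where "w = ordering_product \<beta> u"
    have "forest (set \<beta>)" using fo sets by (metis forest_subset set_append sup_ge2)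
    then have "w \<noteq> u" unfolding w_def
      using u snoc.prems(2) unfolding \<tau> by (intro forest_ordering_product_moves) auto
    have w: "(u, w) \<in> reach (set \<sigma>)"
      unfolding w_def using sets by (intro stay) auto
    \<comment> \<open>As \<open>v\<close> cannot be reached from \<open>u\<close> without
      \<open>a\<close>, the point \<open>w\<close> is neither end of \<open>a\<close> and is fixed
      by it; hence \<tau> keeps \<open>u\<close> in its component.\<close>
    with a have "w \<noteq> v" by auto
    with \<open>w \<noteq> u\<close> a have "ordering_product \<tau> u = ordering_product \<alpha> w"
      by (simp add: \<tau> w_def[symmetric] edge_transposition_doubleton)
    then have "(u, ordering_product \<tau> u) \<in> reach (set \<sigma>)"
      using reach_trans[OF w stay[of \<alpha> w]] sets by auto
    \<comment> \<open>Read through the other word, the image of \<open>u\<close> lies in the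
      component of \<open>v\<close>, so the two components would coincide.\<close>
    moreover have "ordering_product \<tau> u = ordering_product \<sigma> v"
      using a by (simp add: snoc.prems(5)[symmetric] edge_transposition_doubleton)
    ultimately have "(u, v) \<in> reach (set \<sigma>)"
      using stay[of \<sigma> v] by (metis order_refl reach_trans reach_sym)
    with a show False by simp
  qed
  obtain u v where a: "a = {u, v}" "(u, v) \<notin> reach (set \<sigma>)" "(v, u) \<notin> reach (set \<sigma>)"
    using snoc.prems(1,4) by (rule forest_last_edgeE)
  have disj: "e \<inter> a = {}" if "e \<in> set \<beta>" for e
    using that fix_end[of u v] fix_end[of v u] a by (auto simp: insert_commute)
  have "ordering_product \<beta> \<circ> edge_transposition a = edge_transposition a \<circ> ordering_product \<beta>"
    using disj card sets by (intro ordering_product_commute) auto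
  then have "ordering_product (\<alpha> @ \<beta>) \<circ> edge_transposition a = ordering_product \<sigma> \<circ> edge_transposition a"
    using snoc.prems(5) unfolding \<tau>
    by (metis comp_assoc comp_id ordering_product_Cons ordering_product_Nil ordering_product_append)
  then have "ordering_product (\<alpha> @ \<beta>) = ordering_product \<sigma>"
    by (metis comp_assoc comp_id edge_transposition_comp_self)
  then have IH: "touching_order \<sigma> = touching_order (\<alpha> @ \<beta>)"
    using snoc.prems(1,2) \<tau> sets fo by (intro snoc.IH) auto
  have "(e, f) \<in> touching_order (\<sigma> @ [a]) \<longleftrightarrow> (e, f) \<in> touching_order \<tau>" for e f
  proof (cases "e = a \<or> f = a")
    case False
    have "touching_order (\<sigma> @ []) = {(e, f) \<in> touching_order (\<sigma> @ [a]). e \<noteq> a \<and> f \<noteq> a}"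
      using snoc.prems(1) by (intro touching_order_remove)
    moreover have "touching_order (\<alpha> @ \<beta>) = {(e, f) \<in> touching_order \<tau>. e \<noteq> a \<and> f \<noteq> a}"
      unfolding \<tau> using snoc.prems(2) \<tau> by (intro touching_order_remove) simp
    ultimately show ?thesis using IH False by auto
  next
    \<comment> \<open>In both words only edges disjoint from \<open>a\<close> can follow it, so the
      pairs involving \<open>a\<close> are \<open>(a, a)\<close> and \<open>(e, a)\<close> for the
      other edges \<open>e\<close> meeting \<open>a\<close>.\<close>
    case True
    have "a \<notin> set \<sigma>" "a \<notin> set \<alpha>" "a \<notin> set \<beta>" using snoc.prems(1,2) \<tau> by auto
    with True disj sets show ?thesis
      using order_of_list_subset[of \<sigma>] order_of_list_subset[of \<alpha>] order_of_list_subset[of \<beta>]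
      unfolding touching_order_def \<tau>
      by (auto simp: order_of_list_append order_of_list_Cons)
  qed
  then show ?case by auto
qed simp

section \<open>The product over a tree is a full cycle\<close>

text \<open>If an invariant set contained only the end \<open>u\<close> of the last edge, then \<open>\<sigma>\<close> would map its part in
  the component of \<open>u\<close>, minus \<open>u\<close>, bijectively onto that part.\<close>

lemma forest_invariant_set_closed:
  assumes "distinct \<sigma>" "forest (set \<sigma>)" "finite S"
    "\<And>x. ordering_product \<sigma> x \<in> S \<longleftrightarrow> x \<in> S" "{u, v} \<in> set \<sigma>"
  shows "u \<in> S \<longleftrightarrow> v \<in> S"
  using assms
proof (induction \<sigma> arbitrary: u v rule: rev_induct)
  case (snoc a \<sigma>)
  have fo: "forest (set \<sigma>)" using snoc.prems(2) by (rule forest_subset) auto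
  have stay: "(x, ordering_product \<sigma> x) \<in> reach (set \<sigma>)" for x
    using forest_card[OF fo] by (intro ordering_product_reach) auto
  have one_side: "v \<in> S"
    if a: "a = {u, v}" "(u, v) \<notin> reach (set \<sigma>)" and u: "u \<in> S" for u v
  proof (rule ccontr)
    assume v: "v \<notin> S"
    let ?A = "{x \<in> S. (u, x) \<in> reach (set \<sigma>)}"
    have "ordering_product \<sigma> x \<in> S \<longleftrightarrow> x \<in> S \<and> x \<noteq> u" if "(u, x) \<in> reach (set \<sigma>)" for x
    proof -
      have "x \<noteq> v" using that a by auto
      \<comment> \<open>The argument is the preimage of \<open>x\<close> under the transposition
        \<open>a\<close>: it is \<open>v\<close> for \<open>x = u\<close>, and \<open>x\<close>
        itself elsewhere in the component of \<open>u\<close>.\<close>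
      then have "ordering_product (\<sigma> @ [a]) (if x = u then v else x) = ordering_product \<sigma> x"
        using a(1) by (simp add: edge_transposition_doubleton)
      then show ?thesis
        using snoc.prems(4)[of "if x = u then v else x"] v by (simp split: if_splits)
    qed
    moreover have "(u, ordering_product \<sigma> x) \<in> reach (set \<sigma>) \<longleftrightarrow> (u, x) \<in> reach (set \<sigma>)" for x
      using stay[of x] by (metis reach_trans reach_sym)
    ultimately have "ordering_product \<sigma> -` ?A = ?A - {u}" by auto
    moreover have "card (ordering_product \<sigma> -` ?A) = card ?A"
      using bij_ordering_product[of \<sigma>] by (intro card_vimage_inj) (auto simp: bij_def)
    moreover have "card (?A - {u}) < card ?A"
      using snoc.prems(3) u by (intro card_Diff1_less) auto
    ultimately show False by simp
  qed
  obtain p q where a: "a = {p, q}" "(p, q) \<notin> reach (set \<sigma>)" "(q, p) \<notin> reach (set \<sigma>)"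
    using snoc.prems(1,2) by (rule forest_last_edgeE)
  have pq: "p \<in> S \<longleftrightarrow> q \<in> S"
    using one_side[of p q] one_side[of q p] a by (metis insert_commute)
  show ?case
  proof (cases "{u, v} = a")
    case True
    with pq a show ?thesis by (auto simp: doubleton_eq_iff)
  next
    case False
    \<comment> \<open>With both ends of \<open>a\<close> on the same side of \<open>S\<close>, the
      transposition preserves \<open>S\<close>, so invariance passes to \<sigma>.\<close>
    have "edge_transposition a x \<in> S \<longleftrightarrow> x \<in> S" for x
      using pq by (simp add: a(1) edge_transposition_doubleton transpose_def)
    then have inv: "ordering_product \<sigma> x \<in> S \<longleftrightarrow> x \<in> S" for x
      using snoc.prems(4)[of "edge_transposition a x"] by simp
    have "distinct \<sigma>" "{u, v} \<in> set \<sigma>" using snoc.prems(1,5) False by auto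
    with fo snoc.prems(3) inv show ?thesis using snoc.IH by blast
  qed
qed simp

lemma ordering_product_permutes:
  assumes "\<And>e. e \<in> set \<sigma> \<Longrightarrow> card e = 2"
  shows "ordering_product \<sigma> permutes \<Union> (set \<sigma>)"
  using assms bij_ordering_product[of \<sigma>]
  by (auto simp: permutes_def bij_iff ordering_product_untouched)

text \<open>The orbit of 1 is a finite invariant set, hence closed along edges, hence all of
  \<open>{1..n}\<close> by connectedness. So \<open>support\<close> at 1 lists the whole cycle; for
  \<open>n = 1\<close> it has a single entry.\<close>

lemma is_cycle_on_ordering_product:
  assumes tree: "tree_on n E" and \<sigma>: "\<sigma> \<in> orderings E"
  shows "is_cycle_on n (ordering_product \<sigma>)"
proof -
  let ?c = "ordering_product \<sigma>"
  have E: "set \<sigma> = E" "distinct \<sigma>" using \<sigma> by (auto simp: permutations_of_set_def)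
  have card: "\<And>e. e \<in> E \<Longrightarrow> card e = 2" and sub: "\<Union> E \<subseteq> {1..n}" and n: "1 \<in> {1..n}"
    and conn: "\<And>x. x \<in> {1..n} \<Longrightarrow> (1, x) \<in> reach E"
    using tree by (auto simp: tree_on_def simple_graph_on_def graph_connected_def reach_def)
  have fo: "forest E"
    using tree card by (intro forest_if_no_graph_cycle) (auto simp: tree_on_def)
  have perm: "?c permutes {1..n}"
    using ordering_product_permutes[of \<sigma>] card sub E by (metis permutes_subset)
  then have permut: "permutation ?c" by (auto simp: permutation_permutes)
  let ?cs = "support ?c 1"
  have orbit: "set ?cs = range (\<lambda>i. (?c ^^ i) 1)" using permut by (rule support_set)
  have inv: "?c x \<in> set ?cs \<longleftrightarrow> x \<in> set ?cs" for x
  proof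
    assume "x \<in> set ?cs"
    then obtain i where "x = (?c ^^ i) 1" unfolding orbit by blast
    then have "?c x = (?c ^^ Suc i) 1" by simp
    then show "?c x \<in> set ?cs" unfolding orbit by blast
  next
    \<comment> \<open>An injective self-map of a finite set is onto, so the orbit also contains the
      preimages of its points.\<close>
    have "?c ` set ?cs \<subseteq> set ?cs"
    proof
      fix y assume "y \<in> ?c ` set ?cs"
      then obtain i where "y = ?c ((?c ^^ i) 1)" unfolding orbit by blast
      then have "y = (?c ^^ Suc i) 1" by simp
      then show "y \<in> set ?cs" unfolding orbit by blast
    qed
    moreover have "inj ?c" using bij_ordering_product by (rule bij_is_inj)
    ultimately have "?c ` set ?cs = set ?cs"
      by (meson List.finite_set endo_inj_surj inj_on_subset subset_UNIV)
    moreover assume "?c x \<in> set ?cs"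
    ultimately show "x \<in> set ?cs" using \<open>inj ?c\<close> by (metis inj_image_mem_iff)
  qed
  have one: "1 \<in> set ?cs" unfolding orbit by (metis funpow_0 rangeI)
  have "x \<in> set ?cs" if "(1, x) \<in> reach E" for x
    using that unfolding reach_def
  proof (induction rule: rtrancl_induct)
    case (step y z)
    then show ?case
      using forest_invariant_set_closed[of \<sigma> "set ?cs" y z] inv E fo by auto
  qed (rule one)
  with conn have all: "{1..n} \<subseteq> set ?cs" by blast
  have "set ?cs \<subseteq> {1..n}"
    unfolding orbit using permutes_in_funpow_image[OF perm n] by auto
  moreover have "?c = cycle_of_list ?cs"
  proof
    fix x show "?c x = cycle_of_list ?cs x"
    proof (cases "x \<in> set ?cs")
      case True
      with permut show ?thesis by (rule cycle_restrict)
    next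
      case False
      with all have "x \<notin> {1..n}" by blast
      then have "?c x = x" using perm by (rule permutes_not_in[rotated])
      with id_outside_supp[OF False] show ?thesis by simp
    qed
  qed
  moreover have "distinct ?cs" using cycle_of_permutation[OF permut] .
  ultimately show ?thesis
    unfolding is_cycle_on_def using one by (metis empty_iff list.set(1))
qed

section \<open>The poset of an ordering\<close>

text \<open>Two edges are compared in some local suborder precisely when they share a
  vertex.\<close>

lemma ordering_poset_eq_trancl:
  assumes "\<Union> (set \<sigma>) \<subseteq> {1..n}"
  shows "ordering_poset n \<sigma> = (touching_order \<sigma>)\<^sup>+"
proof -
  have "(\<Union>i\<in>{1..n}. local_suborder \<sigma> i) = touching_order \<sigma>"
    using assms order_of_list_subset[of \<sigma>]
    by (fastforce simp: local_suborder_def touching_order_def)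
  then show ?thesis by (simp add: ordering_poset_def)
qed

lemma trancl_touching_order_subset:
  assumes "distinct \<sigma>"
  shows "(touching_order \<sigma>)\<^sup>+ \<subseteq> order_of_list \<sigma>"
proof -
  have "trans (order_of_list \<sigma>)"
    using linear_order_on_order_of_list[OF assms] by (simp add: order_on_defs)
  then have "(order_of_list \<sigma>)\<^sup>+ = order_of_list \<sigma>" by (rule trancl_id)
  moreover have "(touching_order \<sigma>)\<^sup>+ \<subseteq> (order_of_list \<sigma>)\<^sup>+"
    by (rule trancl_mono_subset) (auto simp: touching_order_def)
  ultimately show ?thesis by simp
qed

text \<open>One inclusion suffices because both orders are linear: a touching pair ordered
  differently by \<sigma> would be reversed there by totality, hence reversed in \<tau> too, against
  antisymmetry.\<close>

lemma touching_order_eq_if_subset: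
  assumes "distinct \<sigma>" "distinct \<tau>" "set \<sigma> = set \<tau>" "touching_order \<sigma> \<subseteq> order_of_list \<tau>"
  shows "touching_order \<sigma> = touching_order \<tau>"
proof
  show "touching_order \<sigma> \<subseteq> touching_order \<tau>"
    using assms(4) by (auto simp: touching_order_def)
  show "touching_order \<tau> \<subseteq> touching_order \<sigma>"
  proof (rule subrelI)
    fix e f assume ef: "(e, f) \<in> touching_order \<tau>"
    then have in_set: "e \<in> set \<sigma>" "f \<in> set \<sigma>" and meet: "e \<inter> f \<noteq> {}" "(e, f) \<in> order_of_list \<tau>"
      using order_of_list_subset[of \<tau>] assms(3) by (auto simp: touching_order_def)
    have "(e, f) \<in> order_of_list \<sigma>"
    proof (rule ccontr)
      assume not: "(e, f) \<notin> order_of_list \<sigma>"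
      then have "e \<noteq> f"
        using in_set linear_order_on_order_of_list[OF assms(1)]
        by (auto simp: order_on_defs dest: refl_onD)
      with not have "(f, e) \<in> order_of_list \<sigma>"
        using in_set linear_order_on_order_of_list[OF assms(1)]
        by (auto simp: order_on_defs total_on_def)
      with meet assms(4) have "(f, e) \<in> order_of_list \<tau>"
        unfolding touching_order_def by blast
      with meet \<open>e \<noteq> f\<close> show False
        using linear_order_on_order_of_list[OF assms(2)]
        by (auto simp: order_on_defs dest: antisymD)
    qed
    with meet show "(e, f) \<in> touching_order \<sigma>" by (simp add: touching_order_def)
  qed
qed

section \<open>The bijection between cycles and posets, and the linear extensions\<close>

theorem theorem3p1:
  fixes n :: nat and E :: "nat set set"
  assumes "tree_on n E"
  shows "(\<exists>f. (\<forall>\<sigma>\<in>orderings E. f (ordering_product \<sigma>) = ordering_poset n \<sigma>) \<and>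
              bij_betw f (product_cycles n E) {ordering_poset n \<sigma> | \<sigma>. \<sigma> \<in> orderings E}) \<and>
         (\<forall>\<sigma>\<in>orderings E.
            order_of_list ` {\<tau> \<in> orderings E. ordering_product \<tau> = ordering_product \<sigma>}
              = linear_extensions E (ordering_poset n \<sigma>))"
proof -
  have card: "\<And>e. e \<in> E \<Longrightarrow> card e = 2" and sub: "\<Union> E \<subseteq> {1..n}"
    using assms by (auto simp: tree_on_def simple_graph_on_def)
  have fo: "forest E"
    using assms card by (intro forest_if_no_graph_cycle) (auto simp: tree_on_def)
  have "finite E"
    using sub by (meson finite_UnionD finite_atLeastAtMost finite_subset)
  have D: "set \<sigma> = E" "distinct \<sigma>" if "\<sigma> \<in> orderings E" for \<sigma>
    using that by (auto simp: permutations_of_set_def)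
  have poset: "ordering_poset n \<sigma> = (touching_order \<sigma>)\<^sup>+" if "\<sigma> \<in> orderings E" for \<sigma>
    using that D sub by (intro ordering_poset_eq_trancl) auto
  \<comment> \<open>The right side says that \<tau> is a linear extension of the poset of \<sigma>.
    Both claims of the theorem rest on this equivalence.\<close>
  have key: "ordering_product \<tau> = ordering_product \<sigma> \<longleftrightarrow> ordering_poset n \<sigma> \<subseteq> order_of_list \<tau>"
    if \<sigma>: "\<sigma> \<in> orderings E" and \<tau>: "\<tau> \<in> orderings E" for \<sigma> \<tau>
  proof
    assume "ordering_product \<tau> = ordering_product \<sigma>"
    then have "touching_order \<tau> = touching_order \<sigma>"
      using D[OF \<sigma>] D[OF \<tau>] fo by (intro touching_order_eq_if_ordering_product_eq) auto
    then show "ordering_poset n \<sigma> \<subseteq> order_of_list \<tau>"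
      using trancl_touching_order_subset[of \<tau>] D[OF \<tau>] poset[OF \<sigma>] by simp
  next
    assume "ordering_poset n \<sigma> \<subseteq> order_of_list \<tau>"
    then have "touching_order \<sigma> = touching_order \<tau>"
      using D[OF \<sigma>] D[OF \<tau>] poset[OF \<sigma>] by (intro touching_order_eq_if_subset) auto
    then show "ordering_product \<tau> = ordering_product \<sigma>"
      using D[OF \<sigma>] D[OF \<tau>] card by (intro ordering_product_eq_if_touching_order_eq) auto
  qed
  have poset_iff: "ordering_poset n \<sigma> = ordering_poset n \<tau> \<longleftrightarrow> ordering_product \<sigma> = ordering_product \<tau>"
    if \<sigma>: "\<sigma> \<in> orderings E" and \<tau>: "\<tau> \<in> orderings E" for \<sigma> \<tau>
  proof
    \<comment> \<open>Since \<sigma> extends its own poset, it extends that of \<tau>, and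
      \<open>key\<close> applies.\<close>
    assume "ordering_poset n \<sigma> = ordering_poset n \<tau>"
    then show "ordering_product \<sigma> = ordering_product \<tau>"
      using key[OF \<tau> \<sigma>] key[OF \<sigma> \<sigma>] by simp
  next
    assume "ordering_product \<sigma> = ordering_product \<tau>"
    then have "touching_order \<sigma> = touching_order \<tau>"
      using D[OF \<sigma>] D[OF \<tau>] fo by (intro touching_order_eq_if_ordering_product_eq) auto
    then show "ordering_poset n \<sigma> = ordering_poset n \<tau>" using poset \<sigma> \<tau> by simp
  qed
  \<comment> \<open>Every product over the tree is a cycle, so the cycle condition removes nothing
    from the image.\<close>
  have cycles: "product_cycles n E = ordering_product ` orderings E"
    unfolding product_cycles_def image_def using is_cycle_on_ordering_product[OF assms] by blast
  \<comment> \<open>The poset of an arbitrarily chosen word with product \<open>c\<close>; by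
    \<open>poset_iff\<close> the choice does not affect the value.\<close>
  define f where "f c = ordering_poset n (SOME \<sigma>. \<sigma> \<in> orderings E \<and> ordering_product \<sigma> = c)" for c
  have f: "f (ordering_product \<sigma>) = ordering_poset n \<sigma>" if "\<sigma> \<in> orderings E" for \<sigma>
  proof -
    let ?\<tau> = "SOME \<tau>. \<tau> \<in> orderings E \<and> ordering_product \<tau> = ordering_product \<sigma>"
    have "?\<tau> \<in> orderings E \<and> ordering_product ?\<tau> = ordering_product \<sigma>"
      by (rule someI[of _ \<sigma>]) (simp add: that)
    with that show ?thesis unfolding f_def using poset_iff[of ?\<tau> \<sigma>] by simp
  qed
  have "bij_betw f (product_cycles n E) {ordering_poset n \<sigma> | \<sigma>. \<sigma> \<in> orderings E}"
    unfolding bij_betw_def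
  proof
    show "inj_on f (product_cycles n E)"
    proof (rule inj_onI)
      fix c d assume "c \<in> product_cycles n E" "d \<in> product_cycles n E" and eq: "f c = f d"
      then obtain \<sigma> \<tau> where "\<sigma> \<in> orderings E" "\<tau> \<in> orderings E"
        and "c = ordering_product \<sigma>" "d = ordering_product \<tau>"
        unfolding cycles by blast
      with eq show "c = d" using f[of \<sigma>] f[of \<tau>] poset_iff[of \<sigma> \<tau>] by metis
    qed
    show "f ` product_cycles n E = {ordering_poset n \<sigma> | \<sigma>. \<sigma> \<in> orderings E}"
      unfolding cycles image_image Setcompr_eq_image using f by (intro image_cong) simp_all
  qed
  moreover have "order_of_list ` {\<tau> \<in> orderings E. ordering_product \<tau> = ordering_product \<sigma>}
              = linear_extensions E (ordering_poset n \<sigma>)" if \<sigma>: "\<sigma> \<in> orderings E" for \<sigma>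
  proof
    show "order_of_list ` {\<tau> \<in> orderings E. ordering_product \<tau> = ordering_product \<sigma>}
              \<subseteq> linear_extensions E (ordering_poset n \<sigma>)"
    proof
      fix r assume "r \<in> order_of_list ` {\<tau> \<in> orderings E. ordering_product \<tau> = ordering_product \<sigma>}"
      then obtain \<tau> where \<tau>: "\<tau> \<in> orderings E" "ordering_product \<tau> = ordering_product \<sigma>"
        and r: "r = order_of_list \<tau>" by blast
      have "linear_order_on E r"
        using linear_order_on_order_of_list[of \<tau>] D[OF \<tau>(1)] r by simp
      then show "r \<in> linear_extensions E (ordering_poset n \<sigma>)"
        using key[OF \<sigma> \<tau>(1)] \<tau>(2) r by (simp add: linear_extensions_def)
    qed
    show "linear_extensions E (ordering_poset n \<sigma>)
        \<subseteq> order_of_list ` {\<tau> \<in> orderings E. ordering_product \<tau> = ordering_product \<sigma>}"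
    proof
      fix r assume r: "r \<in> linear_extensions E (ordering_poset n \<sigma>)"
      \<comment> \<open>The extension \<open>r\<close> is itself the order of some word, to which
        \<open>key\<close> can be applied.\<close>
      then obtain \<tau> where \<tau>: "\<tau> \<in> orderings E" "order_of_list \<tau> = r"
        using finite_linear_order_eq_order_of_list[OF \<open>finite E\<close>] by (auto simp: linear_extensions_def)
      with r have "ordering_product \<tau> = ordering_product \<sigma>"
        using key[OF \<sigma> \<tau>(1)] by (simp add: linear_extensions_def)
      with \<tau> show "r \<in> order_of_list ` {\<tau> \<in> orderings E. ordering_product \<tau> = ordering_product \<sigma>}"
        by blast
    qed
  qed
  ultimately show ?thesis using f by blast
qed

end
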